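(* Let $P=\frac1{2^2}\delta_1+\frac12\delta_2+\sum_{j=3}^\infty\frac1{2^j}\delta_j$. The optimal set of two-means for $P$ is given by $\{Av[1,3],Av[4,\infty)\}$ with quantization error $V_2(P)=\frac{17}{28}$.
   Context: $\delta_x$ denotes the Dirac measure at $x\in\mathbb R$. For a Borel probability measure $P$ on $\mathbb R$ and a nonempty finite set $\alpha\subset\mathbb R$, the distortion error is $V(P;\alpha)=\int\min_{a\in\alpha}|x-a|^2\,dP(x)$. The $n$th quantization error is $V_n(P)=\inf\{V(P;\alpha):\alpha\subset\mathbb R,\ 1\le\mathrm{card}(\alpha)\le n\}$. An optimal set of $n$-means for $P$ is a set $\alpha$ with at most $n$ points for which this infimum is attained. With $p_m=P(\{m\})$ and $i\le\ell$ positive integers, $Av[i,\ell]=\frac{\sum_{m=i}^{\ell}p_m m}{\sum_{m=i}^{\ell}p_m}$ and $Av[i,\infty)=\frac{\sum_{m=i}^{\infty}p_m m}{\sum_{m=i}^{\infty}p_m}$. *)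

theory Defs
  imports "HOL-Probability.Probability"
begin

text \<open>
  The distortion is an extended nonnegative integral, so it is \<open>\<infinity>\<close> (rather than a junk value)
  when the integrand is not integrable.
\<close>
definition distortion :: "real measure \<Rightarrow> real set \<Rightarrow> ennreal" where
  "distortion P \<alpha> = (\<integral>\<^sup>+x. ennreal (Min ((\<lambda>a. \<bar>x - a\<bar>\<^sup>2) ` \<alpha>)) \<partial>P)"

definition quantization_error :: "nat \<Rightarrow> real measure \<Rightarrow> ennreal" where
  "quantization_error n P =
     (INF \<alpha>\<in>{\<alpha>. finite \<alpha> \<and> 1 \<le> card \<alpha> \<and> card \<alpha> \<le> n}. distortion P \<alpha>)"

definition optimal_set_of_means :: "nat \<Rightarrow> real measure \<Rightarrow> real set \<Rightarrow> bool" where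
  "optimal_set_of_means n P \<alpha> \<longleftrightarrow>
     finite \<alpha> \<and> 1 \<le> card \<alpha> \<and> card \<alpha> \<le> n \<and> distortion P \<alpha> = quantization_error n P"

definition Av :: "real measure \<Rightarrow> nat \<Rightarrow> nat \<Rightarrow> real" where
  "Av P i l = (\<Sum>m=i..l. measure P {real m} * real m) / (\<Sum>m=i..l. measure P {real m})"

text \<open>
  The average over all integers \<open>m \<ge> i\<close>; both series are shifted to start at index \<open>0\<close>.
\<close>
definition Av_inf :: "real measure \<Rightarrow> nat \<Rightarrow> real" where
  "Av_inf P i = (\<Sum>m. measure P {real (m + i)} * real (m + i)) / (\<Sum>m. measure P {real (m + i)})"

abbreviation dirac :: "real \<Rightarrow> real measure" where
  "dirac x \<equiv> return borel x"

text \<open>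
  The Borel measure \<open>1/2\<^sup>2 \<delta>\<^sub>1 + 1/2 \<delta>\<^sub>2 + \<Sum>j\<ge>3. 1/2\<^sup>j \<delta>\<^sub>j\<close>; the series is shifted to start at index \<open>0\<close>.
\<close>
definition P0 :: "real measure" where
  "P0 = measure_of UNIV (sets borel)
     (\<lambda>A. ennreal (1 / 2\<^sup>2) * emeasure (dirac 1) A + ennreal (1 / 2) * emeasure (dirac 2) A
        + (\<Sum>j. ennreal (1 / 2 ^ (j + 3)) * emeasure (dirac (real (j + 3))) A))"

text \<open>
  Since \<^const>\<open>measure_of\<close> returns the zero measure if its set function is not countably additive,
  we check that \<^term>\<open>P0\<close> has the intended values and is a probability measure.
\<close>

lemma sets_P0 [simp, measurable_cong]: "sets P0 = sets borel"
  by (simp add: P0_def sets.sigma_sets_eq[of borel, simplified])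

lemma space_P0 [simp]: "space P0 = UNIV"
  by (simp add: P0_def)

lemma emeasure_P0:
  assumes "A \<in> sets borel"
  shows "emeasure P0 A =
     ennreal (1 / 2\<^sup>2) * emeasure (dirac 1) A + ennreal (1 / 2) * emeasure (dirac 2) A
        + (\<Sum>j. ennreal (1 / 2 ^ (j + 3)) * emeasure (dirac (real (j + 3))) A)"
    (is "_ = ?f A")
proof -
  have "countably_additive (sets borel) ?f"
  proof (rule countably_additiveI)
    fix A :: "nat \<Rightarrow> real set"
    assume A: "range A \<subseteq> sets borel" "disjoint_family A"
    have d: "(\<Sum>i. c * emeasure (dirac x) (A i)) = c * emeasure (dirac x) (\<Union>i. A i)" for x c
      using A by (simp only: ennreal_suminf_cmult) (simp add: suminf_emeasure del: emeasure_return)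
    have "(\<Sum>i. \<Sum>j. ennreal (1 / 2 ^ (j + 3)) * emeasure (dirac (real (j + 3))) (A i))
        = (\<Sum>j. \<Sum>i. ennreal (1 / 2 ^ (j + 3)) * emeasure (dirac (real (j + 3))) (A i))"
      unfolding nn_integral_count_space_nat[symmetric]
      by (rule trans[OF nn_integral_fst_count_space[where f="\<lambda>(i, j). F i j" for F, simplified]
            nn_integral_snd_count_space[where f="\<lambda>(i, j). F i j" for F, simplified, symmetric]])
    then show "(\<Sum>i. ?f (A i)) = ?f (\<Union>i. A i)"
      by (simp only: d suminf_add[OF summableI summableI, symmetric])
  qed
  moreover have "positive (sets borel) ?f"
    by (simp add: positive_def)
  ultimately show ?thesis
    using assms sets.sigma_algebra_axioms[of "borel :: real measure"]
    by (simp only: P0_def space_borel emeasure_measure_of_sigma)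
qed

lemma prob_space_P0: "prob_space P0"
proof
  have "(\<lambda>j. (1 / 2 ^ 3) * (1 / 2) ^ j :: real) sums ((1 / 2 ^ 3) * 2)"
    by (rule sums_mult) (use geometric_sums[of "1/2 :: real"] in simp)
  then have "(\<lambda>j. 1 / 2 ^ (j + 3) :: real) sums (1 / 4)"
    by (simp add: power_add power_divide mult.commute)
  then have "(\<Sum>j. ennreal (1 / 2 ^ (j + 3))) = ennreal (1 / 4)"
    by (intro suminf_ennreal_eq) auto
  then have "emeasure P0 (space P0) = ennreal (1 / 2\<^sup>2) + ennreal (1 / 2) + ennreal (1 / 4)"
    by (simp add: emeasure_P0)
  also have "\<dots> = ennreal (1 / 2\<^sup>2 + 1 / 2 + 1 / 4)"
    by (simp only: ennreal_plus[symmetric] zero_le_divide_1_iff zero_le_power2 zero_le_numeral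
        add_nonneg_nonneg)
  finally show "emeasure P0 (space P0) = 1"
    by simp
qed

end

theory Submission
  imports Defs "HOL-Real_Asymp.Real_Asymp"
begin

text \<open>
  The measure is carried by the positive integers, so the distortion of \<open>{a, b}\<close> with \<open>a \<le> b\<close> is a
  series in which the integers below the midpoint are served by \<open>a\<close> and the others by \<open>b\<close>.
  Completing squares on both blocks gives the following lower bounds, according to the position of
  \<open>a + b\<close>: \<open>7/6\<close> if the block of \<open>b\<close> contains \<open>2\<close>, \<open>2/3\<close> if it starts at \<open>3\<close>, \<open>17/28\<close> if it starts
  at \<open>4\<close>, with equality only at the two block averages \<open>13/7\<close> and \<open>5\<close>, and \<open>5/8\<close> if the block of
  \<open>a\<close> contains \<open>1, 2, 3, 4\<close>.
\<close>

section \<open>Integration against \<open>P0\<close> as a weighted series\<close>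

definition weight :: "nat \<Rightarrow> real" where
  "weight n = (if n = 0 then 0 else if n = 1 then 1 / 4 else if n = 2 then 1 / 2 else 1 / 2 ^ n)"

lemma weight_nonneg: "0 \<le> weight n"
  by (simp add: weight_def)

lemma weight_simps [simp]:
  "weight 0 = 0" "weight (Suc 0) = 1 / 4"
  "weight 1 = 1 / 4" "weight 2 = 1 / 2" "weight 3 = 1 / 8" "weight 4 = 1 / 16"
  by (simp_all add: weight_def)

lemma weight_ge_3: "3 \<le> k \<Longrightarrow> weight (n + k) = 1 / 2 ^ (n + k)"
  by (simp add: weight_def)

lemma emeasure_P0_singleton: "emeasure P0 {real n} = ennreal (weight n)"
proof -
  have *: "(\<Sum>j. ennreal (1 / 2 ^ (j + 3)) * emeasure (dirac (real (j + 3))) {real n})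
      = (if n \<ge> 3 then ennreal (1 / 2 ^ n) else 0)"
  proof -
    \<comment> \<open>For \<open>n < 3\<close> truncated subtraction gives \<open>n - 3 = 0\<close>,
      and the term at index 0 vanishes because its atom is 3; so one index suffices in both
      cases.\<close>
    have "(\<Sum>j. ennreal (1 / 2 ^ (j + 3)) * emeasure (dirac (real (j + 3))) {real n})
        = (\<Sum>j\<in>{n - 3}. ennreal (1 / 2 ^ (j + 3)) * emeasure (dirac (real (j + 3))) {real n})"
      by (intro suminf_finite) (auto simp: indicator_def)
    also have "\<dots> = (if n \<ge> 3 then ennreal (1 / 2 ^ n) else 0)"
      by (auto simp: indicator_def)
    finally show ?thesis .
  qed
  have [simp]: "1 = real n \<longleftrightarrow> n = 1" "2 = real n \<longleftrightarrow> n = 2"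
    by linarith+
  show ?thesis
    by (subst emeasure_P0) (simp_all only: *, simp_all add: weight_def indicator_def)
qed

lemma measure_P0_singleton: "measure P0 {real n} = weight n"
  by (simp add: measure_def emeasure_P0_singleton weight_nonneg)

lemma AE_P0_nat: "AE x in P0. x \<in> range real"
proof (rule AE_I)
  show "{x \<in> space P0. x \<notin> range real} \<subseteq> - range real"
    by auto
  have m: "- range real \<in> sets borel"
    by (rule borel_comp, rule sets.countable) simp_all
  have *: "real n \<in> - range real \<longleftrightarrow> False" for n
    by auto
  show "emeasure P0 (- range real) = 0"
    \<comment> \<open>The atoms 1 and 2 are numerals and need the two instances; without
      \<open>of_nat_add\<close> the atoms \<open>real (j + 3)\<close> stay visibly in the
      range.\<close>
    using *[of 1] *[of 2] unfolding emeasure_P0[OF m] emeasure_return[OF m]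
    by (simp add: indicator_def del: of_nat_add)
  show "- range real \<in> sets P0"
    using m by simp
qed

text \<open>Almost all points are naturals, so the integral splits over countably many disjoint
  singletons, on each of which \<open>f\<close> is constant.\<close>

lemma nn_integral_P0:
  assumes [measurable]: "f \<in> borel_measurable borel"
  shows "(\<integral>\<^sup>+x. f x \<partial>P0) = (\<Sum>n. f (real n) * ennreal (weight n))"
proof -
  have r: "(\<Union>n. {real n}) = range real"
    by auto
  have "(\<integral>\<^sup>+x. f x \<partial>P0) = (\<integral>\<^sup>+x. f x * indicator (\<Union>n. {real n}) x \<partial>P0)"
    unfolding r by (rule nn_integral_cong_AE) (use AE_P0_nat in eventually_elim, simp)
  also have "\<dots> = (\<Sum>n. \<integral>\<^sup>+x. f x * indicator {real n} x \<partial>P0)"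
    by (intro nn_integral_disjoint_family) (auto simp: disjoint_family_on_def)
  also have "\<dots> = (\<Sum>n. f (real n) * ennreal (weight n))"
  proof (rule suminf_cong)
    fix n
    have "(\<integral>\<^sup>+x. f x * indicator {real n} x \<partial>P0) = (\<integral>\<^sup>+x. f (real n) * indicator {real n} x \<partial>P0)"
      by (intro nn_integral_cong) (auto simp: indicator_def)
    then show "(\<integral>\<^sup>+x. f x * indicator {real n} x \<partial>P0) = f (real n) * ennreal (weight n)"
      by (simp add: nn_integral_cmult_indicator emeasure_P0_singleton)
  qed
  finally show ?thesis .
qed

section \<open>Second moments of geometric tails\<close>

lemma sums_square_div_power_2:
  fixes c :: real
  shows "(\<lambda>n. (real n - c)\<^sup>2 / 2 ^ n) sums (2 * ((c - 1)\<^sup>2 + 2))"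
proof -
  \<comment> \<open>\<open>?g n\<close> is the tail of the series from index \<open>n\<close>, so
    consecutive differences are its terms and \<open>?g 0\<close> is its sum.\<close>
  let ?g = "\<lambda>n. 2 * ((real n - c)\<^sup>2 + 2 * (real n - c) + 3) / 2 ^ n"
  have "?g \<longlonglongrightarrow> 0"
    by real_asymp
  from telescope_sums'[OF this] have "(\<lambda>n. ?g n - ?g (Suc n)) sums (2 * ((c - 1)\<^sup>2 + 2))"
    by (simp add: power2_eq_square algebra_simps)
  moreover have "?g n - ?g (Suc n) = (real n - c)\<^sup>2 / 2 ^ n" for n
    by (simp add: power2_eq_square field_simps)
  ultimately show ?thesis
    by simp
qed

text \<open>From 3 on the weights are geometric: the tail from \<open>k\<close> has mass
  \<open>2 / 2 ^ k\<close>, mean \<open>k + 1\<close> and variance 2.\<close>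

lemma sums_weight_square_tail:
  fixes c :: real
  assumes "3 \<le> k"
  shows "(\<lambda>n. weight (n + k) * (real (n + k) - c)\<^sup>2) sums (2 / 2 ^ k * ((c - real k - 1)\<^sup>2 + 2))"
proof -
  have "(\<lambda>n. 1 / 2 ^ k * ((real n - (c - real k))\<^sup>2 / 2 ^ n)) sums (1 / 2 ^ k * (2 * ((c - real k - 1)\<^sup>2 + 2)))"
    by (intro sums_mult sums_square_div_power_2)
  then show ?thesis
    using assms by (simp add: weight_ge_3 power_add field_simps)
qed

section \<open>Cost of an ordered pair of points\<close>

definition cost :: "real \<Rightarrow> real \<Rightarrow> nat \<Rightarrow> real" where
  "cost a b n = weight n * min ((real n - a)\<^sup>2) ((real n - b)\<^sup>2)"

lemma cost_nonneg: "0 \<le> cost a b n"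
  by (simp add: cost_def weight_nonneg)

lemma square_dist_le_iff:
  fixes a b x :: real
  assumes "a \<le> b"
  shows "x \<le> (a + b) / 2 \<Longrightarrow> (x - a)\<^sup>2 \<le> (x - b)\<^sup>2" "(a + b) / 2 \<le> x \<Longrightarrow> (x - b)\<^sup>2 \<le> (x - a)\<^sup>2"
proof -
  have *: "(x - b)\<^sup>2 - (x - a)\<^sup>2 = (b - a) * (a + b - 2 * x)"
    by (simp add: power2_eq_square algebra_simps)
  show "x \<le> (a + b) / 2 \<Longrightarrow> (x - a)\<^sup>2 \<le> (x - b)\<^sup>2"
    using * assms mult_nonneg_nonneg[of "b - a" "a + b - 2 * x"] by argo
  show "(a + b) / 2 \<le> x \<Longrightarrow> (x - b)\<^sup>2 \<le> (x - a)\<^sup>2"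
    using * assms mult_nonneg_nonpos[of "b - a" "a + b - 2 * x"] by argo
qed

text \<open>Together with \<open>cost_right\<close> this lets an integer at the midpoint count for
  either block, so closed ranges of \<open>a + b\<close> need no tie-breaking.\<close>

lemma cost_left: "a \<le> b \<Longrightarrow> real n \<le> (a + b) / 2 \<Longrightarrow> cost a b n = weight n * (real n - a)\<^sup>2"
  using square_dist_le_iff(1)[of a b "real n"] by (simp add: cost_def min_def)

lemma cost_right: "a \<le> b \<Longrightarrow> (a + b) / 2 \<le> real n \<Longrightarrow> cost a b n = weight n * (real n - b)\<^sup>2"
  using square_dist_le_iff(2)[of a b "real n"] by (simp add: cost_def min_def)

lemma summable_cost: "summable (cost a b)"
proof -
  have "summable (\<lambda>n. weight (n + 3) * (real (n + 3) - a)\<^sup>2)"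
    using sums_weight_square_tail[of 3 a] by (auto simp: sums_iff)
  then have "summable (\<lambda>n. weight n * (real n - a)\<^sup>2)"
    by (subst (asm) summable_iff_shift)
  then show ?thesis
    \<comment> \<open>Serving every integer by \<open>a\<close> alone costs at least as
      much.\<close>
    by (rule summable_comparison_test'[where N = 0])
      (auto simp: cost_def weight_nonneg intro!: mult_left_mono)
qed

lemma suminf_cost_split:
  assumes "a \<le> b" "3 \<le> k" "(a + b) / 2 \<le> real k"
  shows "(\<Sum>n. cost a b n) = (\<Sum>n<k. cost a b n) + 2 / 2 ^ k * ((b - real k - 1)\<^sup>2 + 2)"
proof -
  have "cost a b (n + k) = weight (n + k) * (real (n + k) - b)\<^sup>2" for n
    using assms by (intro cost_right) auto
  then have "(\<Sum>n. cost a b (n + k)) = 2 / 2 ^ k * ((b - real k - 1)\<^sup>2 + 2)"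
    using sums_weight_square_tail[OF \<open>3 \<le> k\<close>, of b] by (simp add: sums_iff)
  then show ?thesis
    using suminf_split_initial_segment[OF summable_cost, of a b k] by simp
qed

lemma suminf_cost_split_at_4:
  assumes "a \<le> b" "6 \<le> a + b" "a + b \<le> 8"
  shows "(\<Sum>n. cost a b n) = 17 / 28 + 7 / 8 * (a - 13 / 7)\<^sup>2 + 1 / 8 * (b - 5)\<^sup>2"
proof -
  \<comment> \<open>As \<open>weight 0 = 0\<close>, this is the block 1, 2, 3: mass 7/8, mean 13/7,
    scatter 5/14. The tail adds 1/4 to the constant.\<close>
  have "(\<Sum>n<4. cost a b n) = 5 / 14 + 7 / 8 * (a - 13 / 7)\<^sup>2"
    using assms by (simp add: lessThan_nat_numeral cost_left)
      (simp add: power2_eq_square field_simps)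
  then show ?thesis
    using suminf_cost_split[of a b 4] assms by (simp add: field_simps)
qed

lemma suminf_cost_gt:
  assumes "a \<le> b" "a + b < 6 \<or> 8 < a + b"
  shows "17 / 28 < (\<Sum>n. cost a b n)"
proof -
  consider "a + b < 4" | "4 \<le> a + b" "a + b < 6" | "8 < a + b"
    using assms by linarith
  then show ?thesis
  proof cases
    case 1
    \<comment> \<open>The integer 1 may be served by either point; only 2, certainly served by
      \<open>b\<close>, is kept from the head.\<close>
    have "(\<Sum>n<3. cost a b n) \<ge> cost a b 2"
      by (intro member_le_sum) (auto simp: cost_nonneg)
    moreover have "cost a b 2 = 1 / 2 * (2 - b)\<^sup>2"
      using 1 assms by (simp add: cost_right)
    moreover have "(\<Sum>n. cost a b n) = (\<Sum>n<3. cost a b n) + 1 / 4 * ((b - 4)\<^sup>2 + 2)"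
      using suminf_cost_split[of a b 3] 1 assms by simp
    \<comment> \<open>8/3 is the mean of the block from 2 on.\<close>
    moreover have "1 / 2 * (2 - b)\<^sup>2 + 1 / 4 * ((b - 4)\<^sup>2 + 2) = 7 / 6 + 3 / 4 * (b - 8 / 3)\<^sup>2"
      by (simp add: power2_eq_square field_simps)
    ultimately show ?thesis
      using zero_le_power2[of "b - 8 / 3"] by linarith
  next
    case 2
    \<comment> \<open>The block 1, 2 has mass 3/4, mean 5/3 and scatter 1/6.\<close>
    have "(\<Sum>n<3. cost a b n) = 1 / 6 + 3 / 4 * (a - 5 / 3)\<^sup>2"
      using 2 assms by (simp add: lessThan_nat_numeral cost_left)
        (simp add: power2_eq_square field_simps)
    moreover have "(\<Sum>n. cost a b n) = (\<Sum>n<3. cost a b n) + 1 / 4 * ((b - 4)\<^sup>2 + 2)"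
      using suminf_cost_split[of a b 3] 2 assms by simp
    ultimately show ?thesis
      using zero_le_power2[of "a - 5 / 3"] zero_le_power2[of "b - 4"] by argo
  next
    case 3
    have "(\<Sum>n<5. cost a b n) = 5 / 8 + 15 / 16 * (a - 2)\<^sup>2"
      using 3 assms by (simp add: lessThan_nat_numeral cost_left)
        (simp add: power2_eq_square field_simps)
    moreover have "(\<Sum>n<5. cost a b n) \<le> (\<Sum>n. cost a b n)"
      by (intro sum_le_suminf summable_cost) (auto simp: cost_nonneg)
    ultimately show ?thesis
      using zero_le_power2[of "a - 2"] by linarith
  qed
qed

lemma suminf_cost_ge:
  assumes "a \<le> b"
  shows "17 / 28 \<le> (\<Sum>n. cost a b n)"
  using suminf_cost_split_at_4[OF assms] suminf_cost_gt[OF assms]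
  by (cases "a + b < 6 \<or> 8 < a + b") auto

lemma suminf_cost_eq_iff:
  assumes "a \<le> b"
  shows "(\<Sum>n. cost a b n) = 17 / 28 \<longleftrightarrow> a = 13 / 7 \<and> b = 5"
proof (cases "a + b < 6 \<or> 8 < a + b")
  case True
  then show ?thesis
    using suminf_cost_gt[OF assms] by auto
next
  case False
  have "7 / 8 * (a - 13 / 7)\<^sup>2 + 1 / 8 * (b - 5)\<^sup>2 = 0 \<longleftrightarrow> a = 13 / 7 \<and> b = 5"
    by (subst add_nonneg_eq_0_iff) auto
  then show ?thesis
    using suminf_cost_split_at_4[OF assms] False by linarith
qed

section \<open>From pairs to the quantization error\<close>

lemma distortion_pair: "distortion P0 {a, b} = ennreal (\<Sum>n. cost a b n)"
proof -
  have "distortion P0 {a, b} = (\<integral>\<^sup>+x. ennreal (min ((x - a)\<^sup>2) ((x - b)\<^sup>2)) \<partial>P0)"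
    by (simp add: distortion_def)
  also have "\<dots> = (\<Sum>n. ennreal (cost a b n))"
    by (subst nn_integral_P0)
      (simp_all add: cost_def ennreal_mult[symmetric] weight_nonneg mult.commute)
  also have "\<dots> = ennreal (\<Sum>n. cost a b n)"
    by (intro suminf_ennreal2 summable_cost cost_nonneg)
  finally show ?thesis .
qed

text \<open>A singleton is the degenerate pair \<open>{a, a}\<close>, so the bounds for ordered
  pairs cover every admissible set.\<close>

lemma card_1_or_2_obtain_pair:
  fixes A :: "'a :: linorder set"
  assumes "1 \<le> card A" "card A \<le> 2"
  obtains a b where "a \<le> b" "A = {a, b}"
proof -
  consider "card A = 1" | "card A = 2"
    using assms by linarith
  then show ?thesis
  proof cases
    case 1
    then show ?thesis
      using that by (metis card_1_singletonE insert_absorb2 order_refl)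
  next
    case 2
    then show ?thesis
      using that by (metis card_2_iff insert_commute linear)
  qed
qed

lemma quantization_error_P0: "quantization_error 2 P0 = ennreal (17 / 28)"
proof (rule antisym)
  have "quantization_error 2 P0 \<le> distortion P0 {13 / 7, 5}"
    unfolding quantization_error_def by (intro INF_lower) simp
  then show "quantization_error 2 P0 \<le> ennreal (17 / 28)"
    by (simp only: distortion_pair suminf_cost_eq_iff[of "13 / 7" 5, THEN iffD2])
  show "ennreal (17 / 28) \<le> quantization_error 2 P0"
    unfolding quantization_error_def
  proof (rule INF_greatest)
    fix \<alpha> :: "real set"
    assume "\<alpha> \<in> {\<alpha>. finite \<alpha> \<and> 1 \<le> card \<alpha> \<and> card \<alpha> \<le> 2}"
    then obtain a b where "a \<le> b" "\<alpha> = {a, b}"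
      using card_1_or_2_obtain_pair by blast
    then show "ennreal (17 / 28) \<le> distortion P0 \<alpha>"
      by (simp only: distortion_pair suminf_cost_ge ennreal_leI)
  qed
qed

section \<open>Block averages and the optimal set\<close>

lemma Av_P0_1_3: "Av P0 1 3 = 13 / 7"
proof -
  have "{1..3} = {1, 2, 3 :: nat}"
    by auto
  then show ?thesis
    by (simp add: Av_def measure_P0_singleton del: One_nat_def)
qed

lemma Av_inf_P0_4: "Av_inf P0 4 = 5"
proof -
  text \<open>Both series are read off the second moments about \<open>0\<close>, \<open>1\<close> and \<open>-1\<close> by polarization.\<close>
  have s: "(\<lambda>n. weight (n + 4) * (real (n + 4) - c)\<^sup>2) sums (((c - 5)\<^sup>2 + 2) / 8)" for c
    using sums_weight_square_tail[of 4 c] by simp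
  have "(\<lambda>n. (weight (n + 4) * (real (n + 4) - (- 1))\<^sup>2 - weight (n + 4) * (real (n + 4) - 1)\<^sup>2) / 4)
      sums ((((- 1 - 5)\<^sup>2 + 2) / 8 - ((1 - 5)\<^sup>2 + 2) / 8) / 4)"
    by (intro sums_divide sums_diff s)
  also have "(\<lambda>n. (weight (n + 4) * (real (n + 4) - (- 1))\<^sup>2 - weight (n + 4) * (real (n + 4) - 1)\<^sup>2) / 4)
      = (\<lambda>n. weight (n + 4) * real (n + 4))"
    by (rule ext) (simp add: power2_eq_square field_simps)
  finally have 1: "(\<lambda>n. weight (n + 4) * real (n + 4)) sums (5 / 8)"
    by simp
  have "(\<lambda>n. (weight (n + 4) * (real (n + 4) - (- 1))\<^sup>2 + weight (n + 4) * (real (n + 4) - 1)\<^sup>2) / 2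
        - weight (n + 4) * (real (n + 4) - 0)\<^sup>2)
      sums ((((- 1 - 5)\<^sup>2 + 2) / 8 + ((1 - 5)\<^sup>2 + 2) / 8) / 2 - ((0 - 5)\<^sup>2 + 2) / 8)"
    by (intro sums_divide sums_diff sums_add s)
  also have "(\<lambda>n. (weight (n + 4) * (real (n + 4) - (- 1))\<^sup>2 + weight (n + 4) * (real (n + 4) - 1)\<^sup>2) / 2
        - weight (n + 4) * (real (n + 4) - 0)\<^sup>2) = (\<lambda>n. weight (n + 4))"
    by (simp add: power2_eq_square field_simps)
  finally have 2: "(\<lambda>n. weight (n + 4)) sums (1 / 8)"
    by simp
  show ?thesis
    unfolding Av_inf_def measure_P0_singleton
    by (simp only: 1[THEN sums_unique, symmetric] 2[THEN sums_unique, symmetric]) simp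
qed

theorem proposition4p1p1:
  shows "(\<forall>\<alpha>. optimal_set_of_means 2 P0 \<alpha> \<longleftrightarrow> \<alpha> = {Av P0 1 3, Av_inf P0 4})
    \<and> quantization_error 2 P0 = ennreal (17 / 28)"
proof (intro conjI allI iffI quantization_error_P0)
  fix \<alpha>
  assume "optimal_set_of_means 2 P0 \<alpha>"
  then have \<alpha>: "1 \<le> card \<alpha>" "card \<alpha> \<le> 2" "distortion P0 \<alpha> = ennreal (17 / 28)"
    by (auto simp: optimal_set_of_means_def quantization_error_P0)
  then obtain a b where ab: "a \<le> b" "\<alpha> = {a, b}"
    using card_1_or_2_obtain_pair by metis
  then have "(\<Sum>n. cost a b n) = 17 / 28"
    \<comment> \<open>\<open>ennreal\<close> truncates negative reals to 0; the lower bound makes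
      the sum nonnegative, so the equality descends to the reals.\<close>
    using \<alpha>(3) suminf_cost_ge[OF ab(1)] by (simp add: distortion_pair)
  then show "\<alpha> = {Av P0 1 3, Av_inf P0 4}"
    unfolding Av_P0_1_3 Av_inf_P0_4 using ab suminf_cost_eq_iff by blast
next
  fix \<alpha>
  assume "\<alpha> = {Av P0 1 3, Av_inf P0 4}"
  then show "optimal_set_of_means 2 P0 \<alpha>"
    unfolding Av_P0_1_3 Av_inf_P0_4
    by (simp add: optimal_set_of_means_def quantization_error_P0 distortion_pair
        suminf_cost_eq_iff[of "13 / 7" 5, THEN iffD2])
qed

end
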